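(* Let $X$ be a real $n\times p$ matrix, $\hat\Sigma:=X^TX/n$, $\underline\lambda>0$, and for each $j\in\{1,\dots,p\}$ let $\tau_j>0$. Let $\hat\gamma_j(\tau_j)$, $\tilde\tau_j^2(\tau_j)$ and $\hat\Theta_j(\tau_j)$ be the node-wise Lasso, the residual sum of squares plus penalty, and the $j$-th column of the surrogate inverse, as defined in the context. Then for all $j$ $$\|e_j-\hat\Sigma\hat\Theta_j(\tau_j)\|_\infty\le\underline\lambda\,\tau_j/\tilde\tau_j^2(\tau_j),$$ and in fact $$e_{j,j}-\big(\hat\Sigma\hat\Theta_j(\tau_j)\big)_j=0,$$ $$\Big|e_{k,j}-\big(\hat\Sigma\hat\Theta_j(\tau_j)\big)_k\Big|\le\underline\lambda\,\tau_j/\tilde\tau_j^2(\tau_j),\qquad k\ne j .$$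
   Context: For $v\in\mathbb{R}^n$, $\|v\|_n:=\sqrt{v^Tv/n}$. $X_j$ is the $j$-th column of $X$ and $X_{-j}=\{X_k\}_{k\ne j}$ is the $n\times(p-1)$ matrix of the other columns. The node-wise Lasso is (any minimizer) $$\hat\gamma_j(\tau_j):=\arg\min_{\gamma_j\in\mathbb{R}^{p-1}}\{\|X_j-X_{-j}\gamma_j\|_n^2+2\underline\lambda\tau_j\|\gamma_j\|_1\},$$ with entries $\hat\gamma_{k,j}(\tau_j)$, $k\ne j$. Define $\tilde\tau_j^2(\tau_j):=\|X_j-X_{-j}\hat\gamma_j(\tau_j)\|_n^2+\underline\lambda\tau_j\|\hat\gamma_j(\tau_j)\|_1$, assumed nonzero. The vector $\hat\Theta_j(\tau_j)\in\mathbb{R}^p$ has $j$-th entry $1/\tilde\tau_j^2(\tau_j)$ and $k$-th entry $-\hat\gamma_{k,j}(\tau_j)/\tilde\tau_j^2(\tau_j)$ for $k\ne j$. $e_j$ is the $j$-th unit vector of $\mathbb{R}^p$, with $k$-th entry $e_{k,j}$. *)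

theory Defs
  imports "HOL-Analysis.Analysis"
begin

definition norm_n :: "real ^ 'n \<Rightarrow> real" where
  "norm_n v = sqrt ((v \<bullet> v) / real CARD('n))"

definition Sigma_hat :: "real ^ 'p ^ 'n \<Rightarrow> real ^ 'p ^ 'p" where
  "Sigma_hat X = (1 / real CARD('n)) *\<^sub>R (transpose X ** X)"

text \<open>A vector of \<open>\<real>\<^bsup>p-1\<^esup>\<close>, with entries indexed by the \<open>k \<noteq> j\<close>, is represented by a function
  \<open>'p \<Rightarrow> real\<close> whose value at \<open>j\<close> is never used: all sums below range over \<open>- {j}\<close>.\<close>

definition mult_minus :: "real ^ 'p ^ 'n \<Rightarrow> 'p \<Rightarrow> ('p \<Rightarrow> real) \<Rightarrow> real ^ 'n" where
  "mult_minus X j \<gamma> = (\<Sum>k\<in>- {j}. \<gamma> k *\<^sub>R column k X)"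

definition l1_minus :: "'p::finite \<Rightarrow> ('p \<Rightarrow> real) \<Rightarrow> real" where
  "l1_minus j \<gamma> = (\<Sum>k\<in>- {j}. \<bar>\<gamma> k\<bar>)"

definition nodewise_objective ::
    "real ^ 'p ^ 'n \<Rightarrow> real \<Rightarrow> 'p \<Rightarrow> real \<Rightarrow> ('p \<Rightarrow> real) \<Rightarrow> real" where
  "nodewise_objective X lam j t \<gamma> =
     (norm_n (column j X - mult_minus X j \<gamma>))\<^sup>2 + 2 * lam * t * l1_minus j \<gamma>"

definition is_nodewise_lasso ::
    "real ^ 'p ^ 'n \<Rightarrow> real \<Rightarrow> 'p \<Rightarrow> real \<Rightarrow> ('p \<Rightarrow> real) \<Rightarrow> bool" where
  "is_nodewise_lasso X lam j t \<gamma> \<longleftrightarrow>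
     is_arg_min (nodewise_objective X lam j t) (\<lambda>_. True) \<gamma>"

text \<open>The penalty enters here without the factor 2 of the objective.\<close>

definition tau_tilde_sq ::
    "real ^ 'p ^ 'n \<Rightarrow> real \<Rightarrow> 'p \<Rightarrow> real \<Rightarrow> ('p \<Rightarrow> real) \<Rightarrow> real" where
  "tau_tilde_sq X lam j t \<gamma> =
     (norm_n (column j X - mult_minus X j \<gamma>))\<^sup>2 + lam * t * l1_minus j \<gamma>"

definition Theta_hat ::
    "real ^ 'p ^ 'n \<Rightarrow> real \<Rightarrow> 'p \<Rightarrow> real \<Rightarrow> ('p \<Rightarrow> real) \<Rightarrow> real ^ 'p" where
  "Theta_hat X lam j t \<gamma> =
     (\<chi> k. if k = j then 1 / tau_tilde_sq X lam j t \<gamma>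
           else - \<gamma> k / tau_tilde_sq X lam j t \<gamma>)"

end

theory Submission
  imports Defs
begin

text \<open>Perturbing a minimizer \<open>\<gamma>\<close> of the node-wise Lasso in the directions \<open>\<plusminus>e\<^sub>k\<close> shows that
  each column \<open>k \<noteq> j\<close> has inner product of absolute value at most \<open>n\<close> times the penalty level with the residual;
  rescaling \<open>\<gamma>\<close> itself, in the directions \<open>\<plusminus>\<gamma>\<close>, gives the exact inner product of the residual with
  the fit. The latter turns the inner product of the residual with column \<open>j\<close> into
  \<open>n\<close> times \<open>tau_tilde_sq\<close>, and the product of \<open>X\<close> with \<open>Theta_hat\<close> is the residual divided by
  \<open>tau_tilde_sq\<close>.\<close>

definition residual :: "real ^ 'p ^ 'n \<Rightarrow> 'p \<Rightarrow> ('p \<Rightarrow> real) \<Rightarrow> real ^ 'n" where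
  "residual X j \<gamma> = column j X - mult_minus X j \<gamma>"

lemma norm_n_sq: "(norm_n (v :: real ^ 'n))\<^sup>2 = (v \<bullet> v) / real CARD('n)"
  by (simp add: norm_n_def)

lemma mult_minus_add_scale:
  "mult_minus X j (\<lambda>k. \<gamma> k + s * h k) = mult_minus X j \<gamma> + s *\<^sub>R mult_minus X j h"
  by (simp add: mult_minus_def scaleR_add_left sum.distrib scaleR_sum_right)

lemma mult_minus_minus: "mult_minus X j (\<lambda>k. - h k) = - mult_minus X j h"
  by (simp add: mult_minus_def sum_negf)

lemma mult_minus_unit:
  assumes "k \<noteq> j"
  shows "mult_minus X j (\<lambda>i. if i = k then a else 0) = a *\<^sub>R column k X"
proof -
  have "mult_minus X j (\<lambda>i. if i = k then a else 0)
      = (\<Sum>i\<in>- {j}. if i = k then a *\<^sub>R column k X else 0)"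
    unfolding mult_minus_def by (rule sum.cong) auto
  then show ?thesis using assms by simp
qed

lemma l1_minus_nonneg: "0 \<le> l1_minus j \<gamma>"
  by (simp add: l1_minus_def sum_nonneg)

lemma l1_minus_scale: "l1_minus j (\<lambda>k. a * \<gamma> k) = \<bar>a\<bar> * l1_minus j \<gamma>"
  by (simp add: l1_minus_def abs_mult sum_distrib_left)

lemma l1_minus_triangle: "l1_minus j (\<lambda>k. \<gamma> k + h k) \<le> l1_minus j \<gamma> + l1_minus j h"
  unfolding l1_minus_def sum.distrib[symmetric] by (intro sum_mono abs_triangle_ineq)

lemma l1_minus_unit: "k \<noteq> j \<Longrightarrow> l1_minus j (\<lambda>i. if i = k then a else 0) = \<bar>a\<bar>"
  by (simp add: l1_minus_def if_distrib[of abs] cong: if_cong)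

lemma tau_tilde_sq_nonneg: "0 \<le> lam * t \<Longrightarrow> 0 \<le> tau_tilde_sq X lam j t \<gamma>"
  by (simp add: tau_tilde_sq_def l1_minus_nonneg)

text \<open>Let \<open>s\<close> tend to 0 from the right. This discards the quadratic remainder of
  a perturbation of size \<open>s\<close>; only small \<open>s\<close> matter, so a range ending at
  1 suffices.\<close>

lemma le_if_le_add_small_multiple:
  fixes a b d :: real
  assumes "\<And>s. 0 < s \<Longrightarrow> s \<le> 1 \<Longrightarrow> a \<le> d + s * b"
  shows "a \<le> d"
proof (rule tendsto_lowerbound)
  show "((\<lambda>s. d + s * b) \<longlongrightarrow> d) (at_right 0)"
    by (auto intro!: tendsto_eq_intros)
  show "\<forall>\<^sub>F s in at_right 0. a \<le> d + s * b"
    unfolding eventually_at_right_field using assms by (intro exI[of _ 1]) auto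
qed simp

text \<open>First-order optimality without subgradients: \<open>d\<close> bounds the growth rate of
  the l1 norm along \<open>h\<close>, and the objective at \<open>\<gamma>\<close> is compared with
  its value at a point moved by \<open>s\<close> along \<open>h\<close>. The factor 2 in the penalty
  matches the 2 of the cross term in the expanded square.\<close>

lemma nodewise_lasso_directional:
  fixes X :: "real ^ 'p ^ 'n"
  assumes lasso: "is_nodewise_lasso X lam j t \<gamma>"
    and "0 \<le> lam * t"
    and l1: "\<And>s. 0 < s \<Longrightarrow> s \<le> 1 \<Longrightarrow> l1_minus j (\<lambda>k. \<gamma> k + s * h k) \<le> l1_minus j \<gamma> + s * d"
  shows "residual X j \<gamma> \<bullet> mult_minus X j h / real CARD('n) \<le> lam * t * d"
proof -
  define r w where "r = residual X j \<gamma>" and "w = mult_minus X j h"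
  define N where "N = real CARD('n)"
  have "r \<bullet> w / N \<le> lam * t * d + s * (w \<bullet> w / N / 2)" if s: "0 < s" "s \<le> 1" for s
  proof -
    let ?\<gamma>s = "\<lambda>k. \<gamma> k + s * h k"
    have r_s: "column j X - mult_minus X j ?\<gamma>s = r - s *\<^sub>R w"
      by (simp add: mult_minus_add_scale r_def residual_def w_def)
    have "nodewise_objective X lam j t \<gamma> \<le> nodewise_objective X lam j t ?\<gamma>s"
      using lasso by (simp add: is_nodewise_lasso_def is_arg_min_linorder)
    then have "r \<bullet> r / N + 2 * (lam * t * l1_minus j \<gamma>)
        \<le> (r - s *\<^sub>R w) \<bullet> (r - s *\<^sub>R w) / N + 2 * (lam * t * l1_minus j ?\<gamma>s)"
      unfolding nodewise_objective_def r_s norm_n_sq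
      by (simp add: r_def residual_def N_def mult.assoc)
    moreover have "(r - s *\<^sub>R w) \<bullet> (r - s *\<^sub>R w) / N
        = r \<bullet> r / N - s * (2 * (r \<bullet> w / N)) + s * (s * (w \<bullet> w / N))"
      by (simp add: inner_diff inner_commute[of w r] add_divide_distrib diff_divide_distrib right_diff_distrib)
    moreover have "lam * t * l1_minus j ?\<gamma>s \<le> lam * t * l1_minus j \<gamma> + s * (lam * t * d)"
      using mult_left_mono[OF l1[OF s] \<open>0 \<le> lam * t\<close>] by (simp add: algebra_simps)
    \<comment> \<open>The values at \<open>\<gamma>\<close> cancel, and a factor \<open>s\<close>
      remains on both sides. Once it is divided out, only the term in \<open>w \<bullet> w\<close>
      still carries an \<open>s\<close>.\<close>
    ultimately have "s * (2 * (r \<bullet> w / N)) \<le> s * (2 * (lam * t * d) + s * (w \<bullet> w / N))"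
      by (simp add: distrib_left)
    then have "2 * (r \<bullet> w / N) \<le> 2 * (lam * t * d) + s * (w \<bullet> w / N)"
      using s by (simp only: mult_le_cancel_left_pos)
    then show ?thesis by argo
  qed
  then show ?thesis
    unfolding r_def w_def N_def by (rule le_if_le_add_small_multiple)
qed

lemma nodewise_lasso_column_bound:
  fixes X :: "real ^ 'p ^ 'n"
  assumes "is_nodewise_lasso X lam j t \<gamma>" "0 \<le> lam * t" "k \<noteq> j"
  shows "\<bar>residual X j \<gamma> \<bullet> column k X / real CARD('n)\<bar> \<le> lam * t"
proof -
  have "residual X j \<gamma> \<bullet> (a *\<^sub>R column k X) / real CARD('n) \<le> lam * t * 1"
    if a: "\<bar>a\<bar> = 1" for a
  proof -
    let ?h = "\<lambda>i. if i = k then a else 0"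
    \<comment> \<open>The triangle inequality gives growth rate 1 for either sign of
      \<open>a\<close>, so no case distinction on the sign or vanishing of \<open>\<gamma> k\<close>
      arises.\<close>
    have "l1_minus j (\<lambda>i. \<gamma> i + s * ?h i) \<le> l1_minus j \<gamma> + s * 1" if "0 < s" for s
      using l1_minus_triangle[of j \<gamma> "\<lambda>i. s * ?h i"] that a
      by (simp add: l1_minus_scale l1_minus_unit[OF \<open>k \<noteq> j\<close>])
    from nodewise_lasso_directional[OF assms(1,2) this] show ?thesis
      by (simp add: mult_minus_unit[OF \<open>k \<noteq> j\<close>])
  qed
  from this[of 1] this[of "-1"] show ?thesis by simp
qed

lemma nodewise_lasso_fit:
  fixes X :: "real ^ 'p ^ 'n"
  assumes "is_nodewise_lasso X lam j t \<gamma>" "0 \<le> lam * t"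
  shows "residual X j \<gamma> \<bullet> mult_minus X j \<gamma> / real CARD('n) = lam * t * l1_minus j \<gamma>"
proof (rule antisym)
  have "l1_minus j (\<lambda>k. \<gamma> k + s * \<gamma> k) \<le> l1_minus j \<gamma> + s * l1_minus j \<gamma>" if "0 < s" for s
    using l1_minus_scale[of j "1 + s" \<gamma>] that by (simp add: algebra_simps)
  from nodewise_lasso_directional[OF assms this]
  show "residual X j \<gamma> \<bullet> mult_minus X j \<gamma> / real CARD('n) \<le> lam * t * l1_minus j \<gamma>" .
next
  \<comment> \<open>Shrinking multiplies the l1 norm by \<open>\<bar>1 - s\<bar>\<close>, which
    equals \<open>1 - s\<close> because \<open>s \<le> 1\<close>. The negative rate yields the
    reverse inequality.\<close>
  have "l1_minus j (\<lambda>k. \<gamma> k + s * - \<gamma> k) \<le> l1_minus j \<gamma> + s * - l1_minus j \<gamma>"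
    if "s \<le> 1" for s
    using l1_minus_scale[of j "1 - s" \<gamma>] that by (simp add: algebra_simps)
  from nodewise_lasso_directional[OF assms this]
  show "lam * t * l1_minus j \<gamma> \<le> residual X j \<gamma> \<bullet> mult_minus X j \<gamma> / real CARD('n)"
    by (simp add: mult_minus_minus)
qed

text \<open>Column \<open>j\<close> is residual plus fit: the residual contributes its squared norm,
  the fit contributes the penalty once. This is why \<open>tau_tilde_sq\<close> has no factor
  2.\<close>

lemma residual_inner_column_self:
  fixes X :: "real ^ 'p ^ 'n"
  assumes "is_nodewise_lasso X lam j t \<gamma>" "0 \<le> lam * t"
  shows "residual X j \<gamma> \<bullet> column j X / real CARD('n) = tau_tilde_sq X lam j t \<gamma>"
proof -
  have "column j X = residual X j \<gamma> + mult_minus X j \<gamma>"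
    by (simp add: residual_def)
  then have "residual X j \<gamma> \<bullet> column j X / real CARD('n)
      = (norm_n (residual X j \<gamma>))\<^sup>2 + residual X j \<gamma> \<bullet> mult_minus X j \<gamma> / real CARD('n)"
    by (simp add: norm_n_sq inner_add_right add_divide_distrib)
  then show ?thesis
    unfolding nodewise_lasso_fit[OF assms] by (simp add: tau_tilde_sq_def residual_def)
qed

text \<open>Up to the factor \<open>1 / tau_tilde_sq X lam j t \<gamma>\<close>, the vector
  \<open>Theta_hat\<close> has entry 1 at \<open>j\<close> and \<open>- \<gamma> k\<close>
  elsewhere, the coefficients that combine the columns of \<open>X\<close> into the
  residual.\<close>

lemma mult_Theta_hat:
  "X *v Theta_hat X lam j t \<gamma> = (1 / tau_tilde_sq X lam j t \<gamma>) *\<^sub>R residual X j \<gamma>"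
proof -
  let ?T = "tau_tilde_sq X lam j t \<gamma>"
  have "X *v Theta_hat X lam j t \<gamma> = (\<Sum>k\<in>UNIV. Theta_hat X lam j t \<gamma> $ k *\<^sub>R column k X)"
    by (simp add: matrix_mult_sum scalar_mult_eq_scaleR)
  also have "\<dots> = Theta_hat X lam j t \<gamma> $ j *\<^sub>R column j X
      + (\<Sum>k\<in>- {j}. Theta_hat X lam j t \<gamma> $ k *\<^sub>R column k X)"
    by (subst sum.remove[of _ j]) (auto simp: Compl_eq_Diff_UNIV)
  also have "(\<Sum>k\<in>- {j}. Theta_hat X lam j t \<gamma> $ k *\<^sub>R column k X)
      = (\<Sum>k\<in>- {j}. - ((1 / ?T) *\<^sub>R \<gamma> k *\<^sub>R column k X))"
    by (rule sum.cong) (auto simp: Theta_hat_def)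
  also have "\<dots> = - ((1 / ?T) *\<^sub>R mult_minus X j \<gamma>)"
    by (simp add: mult_minus_def sum_negf scaleR_sum_right)
  finally show ?thesis
    by (simp add: Theta_hat_def residual_def scaleR_diff_right)
qed

text \<open>Applying \<open>X\<close> first and its transpose second reduces the entries of
  \<open>Sigma_hat X *v Theta_hat X lam j t \<gamma>\<close> to the inner products of residual and
  columns studied above.\<close>

lemma Sigma_hat_mult_component:
  fixes X :: "real ^ 'p ^ 'n"
  shows "(Sigma_hat X *v v) $ k = ((X *v v) \<bullet> column k X) / real CARD('n)"
proof -
  have "Sigma_hat X *v v = (1 / real CARD('n)) *\<^sub>R (transpose X *v (X *v v))"
    by (simp add: Sigma_hat_def matrix_vector_mul_assoc scaleR_matrix_vector_assoc)
  moreover have "(transpose X *v u) $ k = u \<bullet> column k X" for u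
    by (simp add: matrix_vector_mul_component column_def transpose_def inner_vec_def mult.commute)
  ultimately show ?thesis by simp
qed

lemma infnorm_cart_le:
  fixes v :: "real ^ 'n"
  assumes "\<And>i. \<bar>v $ i\<bar> \<le> b"
  shows "infnorm v \<le> b"
  unfolding infnorm_cart using assms by (intro cSup_least) auto

theorem lemma2p3p1:
  fixes X :: "real ^ 'p ^ 'n"
    and lam :: real
    and \<tau> :: "'p \<Rightarrow> real"
    and \<gamma> :: "'p \<Rightarrow> 'p \<Rightarrow> real"
  assumes "lam > 0"
    and "\<And>j. \<tau> j > 0"
    and "\<And>j. is_nodewise_lasso X lam j (\<tau> j) (\<gamma> j)"
  shows "\<forall>j. tau_tilde_sq X lam j (\<tau> j) (\<gamma> j) \<noteq> 0 \<longrightarrow>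
      infnorm (axis j 1 - Sigma_hat X *v Theta_hat X lam j (\<tau> j) (\<gamma> j))
        \<le> lam * \<tau> j / tau_tilde_sq X lam j (\<tau> j) (\<gamma> j) \<and>
      axis j 1 $ j - (Sigma_hat X *v Theta_hat X lam j (\<tau> j) (\<gamma> j)) $ j = 0 \<and>
      (\<forall>k. k \<noteq> j \<longrightarrow>
        \<bar>axis j 1 $ k - (Sigma_hat X *v Theta_hat X lam j (\<tau> j) (\<gamma> j)) $ k\<bar>
          \<le> lam * \<tau> j / tau_tilde_sq X lam j (\<tau> j) (\<gamma> j))"
proof (intro allI impI)
  fix j
  let ?T = "tau_tilde_sq X lam j (\<tau> j) (\<gamma> j)"
  let ?e = "axis j 1 - Sigma_hat X *v Theta_hat X lam j (\<tau> j) (\<gamma> j)"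
  assume "?T \<noteq> 0"
  \<comment> \<open>A nonnegative penalty level makes \<open>?T\<close> nonnegative, hence positive;
    the sign is what lets the division by \<open>?T\<close> preserve the bounds on absolute
    values.\<close>
  have c: "0 \<le> lam * \<tau> j" using assms(1) assms(2)[of j] by simp
  with \<open>?T \<noteq> 0\<close> have "?T > 0" using tau_tilde_sq_nonneg[OF c, of X j "\<gamma> j"] by simp
  have \<Sigma>\<Theta>: "(Sigma_hat X *v Theta_hat X lam j (\<tau> j) (\<gamma> j)) $ k
      = residual X j (\<gamma> j) \<bullet> column k X / real CARD('n) / ?T" for k
    by (simp add: Sigma_hat_mult_component mult_Theta_hat)
  \<comment> \<open>The numerator in entry \<open>j\<close> is \<open>?T\<close> itself, so the
    quotient is exactly 1.\<close>
  have diag: "axis j 1 $ j - (Sigma_hat X *v Theta_hat X lam j (\<tau> j) (\<gamma> j)) $ j = 0"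
    unfolding \<Sigma>\<Theta> residual_inner_column_self[OF assms(3) c]
    using \<open>?T \<noteq> 0\<close> by (simp add: axis_def)
  have off: "\<bar>axis j 1 $ k - (Sigma_hat X *v Theta_hat X lam j (\<tau> j) (\<gamma> j)) $ k\<bar>
      \<le> lam * \<tau> j / ?T" if "k \<noteq> j" for k
  proof -
    have "axis j (1::real) $ k = 0" using that by (simp add: axis_def)
    then have "\<bar>axis j 1 $ k - (Sigma_hat X *v Theta_hat X lam j (\<tau> j) (\<gamma> j)) $ k\<bar>
        = \<bar>residual X j (\<gamma> j) \<bullet> column k X / real CARD('n)\<bar> / ?T"
      using \<open>?T > 0\<close> unfolding \<Sigma>\<Theta> by (simp add: abs_divide)
    also have "\<dots> \<le> lam * \<tau> j / ?T"
      using nodewise_lasso_column_bound[OF assms(3) c that] \<open>?T > 0\<close>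
      by (intro divide_right_mono) auto
    finally show ?thesis .
  qed
  \<comment> \<open>Entry \<open>j\<close> is zero and satisfies the bound because the right-hand
    side is nonnegative.\<close>
  have "\<bar>?e $ k\<bar> \<le> lam * \<tau> j / ?T" for k
    using off[of k] diag c \<open>?T > 0\<close> by (cases "k = j") auto
  then have "infnorm ?e \<le> lam * \<tau> j / ?T"
    by (rule infnorm_cart_le)
  with diag off show "infnorm ?e \<le> lam * \<tau> j / ?T \<and>
      axis j 1 $ j - (Sigma_hat X *v Theta_hat X lam j (\<tau> j) (\<gamma> j)) $ j = 0 \<and>
      (\<forall>k. k \<noteq> j \<longrightarrow>
        \<bar>axis j 1 $ k - (Sigma_hat X *v Theta_hat X lam j (\<tau> j) (\<gamma> j)) $ k\<bar>
          \<le> lam * \<tau> j / ?T)"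
    by blast
qed

end
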